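(* Let $\lambda>2^{\omega}$ be a regular cardinal and suppose that both $\bigstar(S)$ and $\diamondsuit(S)$ hold for some stationary set $S\subseteq E^{\lambda}_{\omega_1}$. Then: (1) there is an $\omega$-almost disjoint $\clubsuit(S^* )$-sequence for some $S^*\subseteq S$, and hence $\chi_{\rm CF}(\lambda,\omega_1,\omega)=\chi(\lambda,\omega_1,\omega)=\lambda$; (2) for every cardinal $\kappa$ with $\omega_2\le\kappa<\lambda$, $\omega_2\le\chi_{\rm CF}(\lambda,\kappa,\omega)$.
   Context: $E^{\lambda}_{\omega_1}=\{\alpha<\lambda:\operatorname{cf}(\alpha)=\omega_1\}$. $\bigstar(S)$: there is an $\omega$-almost disjoint family $\{A_\alpha:\alpha\in S\}$ (distinct members have finite intersection) such that each $A_\alpha$ is a cofinal subset of $\alpha$ of order type $\omega_1$. $\diamondsuit(S)$ is Jensen's diamond principle on $S$. For $S\subseteq\lambda$, a $\clubsuit(S)$-sequence is a sequence $\{B_\alpha:\alpha\in S\}$ with $\bigcup B_\alpha=\alpha$ for each $\alpha\in S$ such that for every $X\in[\lambda]^{\lambda}$ some $\alpha\in S$ has $B_\alpha\subseteq X$; it is $\omega$-almost disjoint if distinct $B_\alpha$ have finite intersection. For a family $\mathcal A$ (members with at least two elements) and cardinal $\rho$: $\chi(\mathcal A)$ is the least $\rho$ admitting $f:\bigcup\mathcal A\to\rho$ non-constant on each $A\in\mathcal A$; $\chi_{\rm CF}(\mathcal A)$ is the least $\rho$ admitting $f:\bigcup\mathcal A\to\rho$ such that each $A\in\mathcal A$ has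 some $\zeta$ with $|A\cap f^{-1}\{\zeta\}|=1$. A $(\lambda,\kappa,\mu)$-system is a family of $\lambda$ sets each of size $\kappa$, distinct members meeting in fewer than $\mu$ points; $\chi(\lambda,\kappa,\mu)$, $\chi_{\rm CF}(\lambda,\kappa,\mu)$ are the suprema of $\chi(\mathcal A)$, $\chi_{\rm CF}(\mathcal A)$ over all such systems. *)

theory Defs
  imports Main "HOL-Library.Countable_Set"
begin

text \<open>The regular cardinal lambda is modelled as the order type of a
well-ordered type 'a: the ordinals below lambda are the elements of 'a.\<close>

definition is_cardinal_type :: "'a::wellorder itself \<Rightarrow> bool" where
  "is_cardinal_type T \<longleftrightarrow>
     (\<forall>x::'a. \<not> (\<exists>f::'a \<Rightarrow> 'a. inj f \<and> range f \<subseteq> {..<x}))"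

definition is_regular_type :: "'a::wellorder itself \<Rightarrow> bool" where
  "is_regular_type T \<longleftrightarrow> is_cardinal_type T \<and> infinite (UNIV::'a set) \<and>
     (\<forall>X::'a set. (\<forall>x. \<exists>y\<in>X. x \<le> y) \<longrightarrow> (\<exists>f. bij_betw f X (UNIV::'a set)))"

definition above_continuum :: "'a itself \<Rightarrow> bool" where
  "above_continuum T \<longleftrightarrow> \<not> (\<exists>f::'a \<Rightarrow> nat set. inj f)"

definition is_cardinal_ord :: "'a::wellorder \<Rightarrow> bool" where
  "is_cardinal_ord k \<longleftrightarrow> (\<forall>j<k. \<not> (\<exists>f. bij_betw f {..<k} {..<j}))"

definition omega1 :: "'a::wellorder" where
  "omega1 = (LEAST x. uncountable {..<x})"

definition otype_omega1 :: "'a::wellorder set \<Rightarrow> bool" where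
  "otype_omega1 A \<longleftrightarrow> uncountable A \<and> (\<forall>x\<in>A. countable {y\<in>A. y < x})"

definition cofinal_in :: "'a::wellorder set \<Rightarrow> 'a \<Rightarrow> bool" where
  "cofinal_in A \<alpha> \<longleftrightarrow> A \<subseteq> {..<\<alpha>} \<and> (\<forall>\<beta><\<alpha>. \<exists>\<gamma>\<in>A. \<beta> \<le> \<gamma>)"

text \<open>cf(alpha) = omega_1 (omega_1 is regular, so this is equivalent to having
a cofinal subset of order type omega_1).\<close>
definition cf_omega1 :: "'a::wellorder \<Rightarrow> bool" where
  "cf_omega1 \<alpha> \<longleftrightarrow> (\<exists>A. cofinal_in A \<alpha> \<and> otype_omega1 A)"

definition club :: "'a::wellorder set \<Rightarrow> bool" where
  "club C \<longleftrightarrow> (\<forall>x. \<exists>y\<in>C. x \<le> y) \<and>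
     (\<forall>\<alpha>. (\<exists>\<beta>. \<beta> < \<alpha>) \<and> (\<forall>\<beta><\<alpha>. \<exists>\<gamma>\<in>C. \<beta> < \<gamma> \<and> \<gamma> < \<alpha>) \<longrightarrow> \<alpha> \<in> C)"

definition stationary :: "'a::wellorder set \<Rightarrow> bool" where
  "stationary S \<longleftrightarrow> (\<forall>C. club C \<longrightarrow> S \<inter> C \<noteq> {})"

definition bigstar :: "'a::wellorder set \<Rightarrow> bool" where
  "bigstar S \<longleftrightarrow> (\<exists>A. (\<forall>\<alpha>\<in>S. cofinal_in (A \<alpha>) \<alpha> \<and> otype_omega1 (A \<alpha>)) \<and>
      (\<forall>\<alpha>\<in>S. \<forall>\<beta>\<in>S. \<alpha> \<noteq> \<beta> \<longrightarrow> finite (A \<alpha> \<inter> A \<beta>)))"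

definition diamond :: "'a::wellorder set \<Rightarrow> bool" where
  "diamond S \<longleftrightarrow> (\<exists>A. (\<forall>\<alpha>\<in>S. A \<alpha> \<subseteq> {..<\<alpha>}) \<and>
      (\<forall>X. stationary {\<alpha>\<in>S. X \<inter> {..<\<alpha>} = A \<alpha>}))"

definition clubsuit_seq :: "'a::wellorder set \<Rightarrow> ('a \<Rightarrow> 'a set) \<Rightarrow> bool" where
  "clubsuit_seq S B \<longleftrightarrow> (\<forall>\<alpha>\<in>S. cofinal_in (B \<alpha>) \<alpha>) \<and>
     (\<forall>X::'a set. (\<exists>f. bij_betw f X (UNIV::'a set)) \<longrightarrow> (\<exists>\<alpha>\<in>S. B \<alpha> \<subseteq> X))"

definition almost_disjoint_seq :: "'a set \<Rightarrow> ('a \<Rightarrow> 'b set) \<Rightarrow> bool" where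
  "almost_disjoint_seq S B \<longleftrightarrow> (\<forall>\<alpha>\<in>S. \<forall>\<beta>\<in>S. \<alpha> \<noteq> \<beta> \<longrightarrow> finite (B \<alpha> \<inter> B \<beta>))"

definition omega_system :: "'b set set \<Rightarrow> 'a set \<Rightarrow> 'c set \<Rightarrow> bool" where
  "omega_system \<A> L K \<longleftrightarrow> (\<exists>f. bij_betw f \<A> L) \<and> (\<forall>A\<in>\<A>. \<exists>g. bij_betw g A K) \<and>
     (\<forall>A\<in>\<A>. \<forall>B\<in>\<A>. A \<noteq> B \<longrightarrow> finite (A \<inter> B))"

definition colorable_by :: "'b set set \<Rightarrow> 'c set \<Rightarrow> bool" where
  "colorable_by \<A> R \<longleftrightarrow> (\<exists>f. f ` \<Union>\<A> \<subseteq> R \<and> (\<forall>A\<in>\<A>. \<exists>x\<in>A. \<exists>y\<in>A. f x \<noteq> f y))"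

definition cf_colorable_by :: "'b set set \<Rightarrow> 'c set \<Rightarrow> bool" where
  "cf_colorable_by \<A> R \<longleftrightarrow> (\<exists>f. f ` \<Union>\<A> \<subseteq> R \<and>
      (\<forall>A\<in>\<A>. \<exists>z. \<exists>!x. x \<in> A \<and> f x = z))"

end

theory Submission
  imports Defs "HOL-Library.Equipollence"
begin

text \<open>
  Diamond, applied to codes of functions, guesses every injection F from the cardinal to itself on
  an initial segment. Transport the almost disjoint ladders of the star principle along the guessed
  functions and keep only those images that are almost disjoint from all earlier ones. If no
  correct guess of F survived, then by pressing down some fixed image would meet the images of more
  than continuum many ladders under F in an infinite set; these images are almost disjoint, so
  distinct ones have distinct countable traces, and a set of size \<open>\<omega>\<^sub>1\<close> has only continuum
  many countable subsets.

  For (1), F enumerates the set to be captured. For (2), add to the surviving images, whose points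
  are taken from different blocks, one block of size \<open>\<kappa>\<close> each: F can be chosen so that the image
  repeats each colour that occurs in unboundedly many blocks, and for all but boundedly many blocks
  only such colours occur in the block.
\<close>

section \<open>Cardinality\<close>

lemma lepoll_total: "A \<lesssim> B \<or> B \<lesssim> A"
  using ordLeq_total[OF card_of_Well_order card_of_Well_order, of A B]
  by (simp add: lepoll_def card_of_ordLeq)

lemma UN_lepoll_infinite:
  assumes "infinite B" "I \<lesssim> B" "\<And>i. i \<in> I \<Longrightarrow> A i \<lesssim> B"
  shows "(\<Union>i\<in>I. A i) \<lesssim> B"
  using card_of_UNION_ordLeq_infinite[of B I A] assms
  by (simp add: lepoll_def card_of_ordLeq)

lemma Un_lepoll_infinite:
  assumes "infinite C" "A \<lesssim> C" "B \<lesssim> C"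
  shows "A \<union> B \<lesssim> C"
proof -
  have "(\<Union>i\<in>UNIV. if i then A else B) \<lesssim> C"
    by (rule UN_lepoll_infinite) (use assms finite_lepoll_infinite[of C "UNIV :: bool set"] in auto)
  then show ?thesis
    by (simp add: UNIV_bool Un_commute)
qed

lemma infinite_times_self_eqpoll: "infinite A \<Longrightarrow> A \<times> A \<approx> A"
  by (simp add: card_of_Times_same_infinite eqpoll_iff_card_of_ordIso)

lemma countable_lepoll_infinite: "countable A \<Longrightarrow> infinite B \<Longrightarrow> A \<lesssim> B"
  by (metis countableE infinite_le_lepoll lepoll_def lepoll_trans subset_UNIV)

section \<open>Uncountable sets and sets of order type omega_1\<close>

lemma uncountable_UNIV_nat_set: "uncountable (UNIV :: nat set set)"
  using lesspoll_Pow_self[of "UNIV :: nat set"] infinite_UNIV_nat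
  by (metis Pow_UNIV countable_lepoll_infinite lepoll_antisym lesspoll_def)

text \<open>Proper initial segments of \<open>A\<close> are countable, so an uncountable subset is
  unbounded in \<open>A\<close>. If the claim failed, \<open>B\<close> would embed as such a subset,
  and \<open>A\<close> would be a union of at most |B| countable segments.\<close>

lemma otype_omega1_lepoll:
  assumes A: "otype_omega1 A" and B: "uncountable B"
  shows "A \<lesssim> B"
proof (rule ccontr)
  assume "\<not> A \<lesssim> B"
  then obtain f where f: "inj_on f B" "f ` B \<subseteq> A"
    using lepoll_total[of A B] by (auto simp: lepoll_def)
  have unc: "uncountable (f ` B)"
    using B f(1) countable_image_inj_on by blast
  have "A \<subseteq> (\<Union>b\<in>f ` B. {y\<in>A. y < b})"
  proof
    fix y assume y: "y \<in> A"
    have "countable (insert y {z\<in>A. z < y})"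
      using A y by (simp add: otype_omega1_def)
    then have "\<not> f ` B \<subseteq> insert y {z\<in>A. z < y}"
      using unc countable_subset by blast
    then obtain b where "b \<in> f ` B" "b \<notin> insert y {z\<in>A. z < y}"
      by blast
    moreover from this have "y < b"
      using f(2) by (metis (mono_tags, lifting) insertCI linorder_neqE mem_Collect_eq subsetD)
    ultimately have "\<exists>b\<in>f ` B. y < b"
      by blast
    then show "y \<in> (\<Union>b\<in>f ` B. {y\<in>A. y < b})"
      using y by blast
  qed
  moreover have "(\<Union>b\<in>f ` B. {y\<in>A. y < b}) \<lesssim> B"
  proof (rule UN_lepoll_infinite)
    show "infinite B"
      using B countable_finite by blast
    then show "{y\<in>A. y < b} \<lesssim> B" if "b \<in> f ` B" for b
      using that A f(2) by (intro countable_lepoll_infinite) (auto simp: otype_omega1_def)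
  qed (rule image_lepoll)
  ultimately show False
    using \<open>\<not> A \<lesssim> B\<close> lepoll_trans subset_imp_lepoll by blast
qed

lemma otype_omega1_eqpoll: "otype_omega1 A \<Longrightarrow> otype_omega1 B \<Longrightarrow> A \<approx> B"
  by (meson lepoll_antisym otype_omega1_def otype_omega1_lepoll)

text \<open>A set of size at most continuum has at most continuum many countable subsets, and each of
  them is contained in at most one member of the family.\<close>

lemma almost_disjoint_infinite_traces_lepoll:
  fixes B :: "'i \<Rightarrow> 'c set"
  assumes E: "E \<lesssim> (UNIV :: nat set set)"
    and inf: "\<And>i. i \<in> I \<Longrightarrow> infinite (B i \<inter> E)"
    and ad: "\<And>i j. i \<in> I \<Longrightarrow> j \<in> I \<Longrightarrow> i \<noteq> j \<Longrightarrow> finite (B i \<inter> B j)"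
  shows "I \<lesssim> (UNIV :: nat set set)"
proof -
  obtain j :: "'c \<Rightarrow> nat set" where j: "inj_on j E"
    using E by (auto simp: lepoll_def)
  have "\<exists>s :: nat \<Rightarrow> 'c. inj s \<and> range s \<subseteq> B i \<inter> E" if "i \<in> I" for i
    using inf[OF that] infinite_countable_subset by blast
  then obtain s :: "'i \<Rightarrow> nat \<Rightarrow> 'c"
    where s: "\<And>i. i \<in> I \<Longrightarrow> inj (s i) \<and> range (s i) \<subseteq> B i \<inter> E"
    by metis
  \<comment> \<open>One set of naturals stores the whole sequence: column n holds the set of
    naturals that \<open>j\<close> assigns to the n-th chosen point of the trace.\<close>
  define code where "code i = {prod_encode (n, m) |n m. m \<in> j (s i n)}" for i
  have decode: "m \<in> j (s i n) \<longleftrightarrow> prod_encode (n, m) \<in> code i" for m i n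
    by (auto simp: code_def)
  have "inj_on code I"
  proof
    fix a b assume ab: "a \<in> I" "b \<in> I" "code a = code b"
    have "s a n = s b n" for n
    proof (rule inj_onD[OF j])
      show "j (s a n) = j (s b n)"
        using decode ab(3) by blast
    qed (use s[OF ab(1)] s[OF ab(2)] in auto)
    then have "s a = s b" ..
    then have "range (s a) \<subseteq> B a \<inter> B b"
      using s[OF ab(1)] s[OF ab(2)] by auto
    then have "infinite (B a \<inter> B b)"
      using s[OF ab(1)] finite_subset range_inj_infinite by blast
    then show "a = b"
      using ad ab by blast
  qed
  then show ?thesis
    by (auto simp: lepoll_def)
qed

section \<open>Diamond on a regular cardinal above the continuum\<close>

text \<open>Stationarity is used only through clubs of this form. The least element satisfies the
  condition vacuously.\<close>

definition closed_under :: "('a::wellorder \<Rightarrow> 'a) \<Rightarrow> 'a \<Rightarrow> bool" where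
  "closed_under h \<alpha> \<longleftrightarrow> (\<forall>\<xi><\<alpha>. h \<xi> < \<alpha>)"

lemma closed_under_max:
  "closed_under (\<lambda>\<xi>. max (g \<xi>) (h \<xi>)) \<alpha> \<longleftrightarrow> closed_under g \<alpha> \<and> closed_under h \<alpha>"
  by (auto simp: closed_under_def)

locale regular_above_continuum =
  fixes T :: "'a::wellorder itself"
  assumes regular: "is_regular_type T" and above: "above_continuum T"
begin

section \<open>Bounded subsets of a regular cardinal above the continuum\<close>

lemma infinite_UNIV: "infinite (UNIV :: 'a set)"
  using regular by (simp add: is_regular_type_def)

lemma not_UNIV_lepoll_lessThan: "\<not> (UNIV :: 'a set) \<lesssim> {..<x::'a}"
  using regular by (auto simp: is_regular_type_def is_cardinal_type_def lepoll_def)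

lemma not_UNIV_lepoll_continuum: "\<not> (UNIV :: 'a set) \<lesssim> (UNIV :: nat set set)"
  using above by (auto simp: above_continuum_def lepoll_def)

text \<open>Contrapositive of regularity, where unbounded sets have full size. By comparability,
  \<open>\<not> UNIV \<lesssim> Y\<close> expresses that \<open>Y\<close> has size below
  \<lambda>.\<close>

lemma small_bounded:
  assumes "\<not> (UNIV :: 'a set) \<lesssim> Y"
  shows "\<exists>y::'a. \<forall>x\<in>Y. x < y"
proof (rule ccontr)
  assume "\<not> ?thesis"
  then have "\<forall>x. \<exists>y\<in>Y. x \<le> y"
    by (meson not_less)
  then have "Y \<approx> (UNIV :: 'a set)"
    using regular by (auto simp: is_regular_type_def eqpoll_def)
  then show False
    using assms eqpoll_imp_lepoll eqpoll_sym by blast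
qed

lemma small_bounded_lepoll:
  assumes "Y \<lesssim> Z" "\<not> (UNIV :: 'a set) \<lesssim> Z"
  shows "\<exists>y::'a. \<forall>x\<in>Y. x < y"
  using assms lepoll_trans small_bounded by blast

lemma unbounded_eqpoll:
  assumes "\<And>x::'a. \<exists>y\<in>X. x \<le> y"
  shows "X \<approx> (UNIV :: 'a set)"
  using regular assms by (auto simp: is_regular_type_def eqpoll_def)

lemma countable_bounded: "countable Y \<Longrightarrow> \<exists>y::'a. \<forall>x\<in>Y. x < y"
  using small_bounded_lepoll[of Y "UNIV :: nat set set"] not_UNIV_lepoll_continuum
  by (meson countable_finite countable_lepoll_infinite uncountable_UNIV_nat_set)

lemma ex_greater: "\<exists>y. x < (y::'a)"
  using countable_bounded[of "{x}"] by simp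

text \<open>This makes the \<open>LEAST\<close> in the definition of \<open>omega1\<close>
  meaningful. Comparability embeds the continuum into \<lambda>, and the image, being small, is
  bounded.\<close>

lemma ex_uncountable_lessThan: "\<exists>x::'a. uncountable {..<x}"
proof -
  obtain f :: "nat set \<Rightarrow> 'a" where f: "inj f"
    using lepoll_total not_UNIV_lepoll_continuum by (metis lepoll_def)
  obtain y where "\<forall>x\<in>range f. x < y"
    using small_bounded_lepoll[OF image_lepoll not_UNIV_lepoll_continuum] by blast
  then have "range f \<subseteq> {..<y}"
    by auto
  moreover have "uncountable (range f)"
    using f uncountable_UNIV_nat_set countable_image_inj_on by blast
  ultimately show ?thesis
    using countable_subset by blast
qed

lemma otype_omega1_lessThan_omega1: "otype_omega1 {..<omega1::'a}"
proof -
  have "uncountable {..<omega1::'a}"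
    unfolding omega1_def by (rule LeastI_ex[OF ex_uncountable_lessThan])
  moreover have "countable {y\<in>{..<omega1}. y < x}" if "x < omega1" for x :: 'a
  proof -
    have "{y\<in>{..<omega1}. y < x} = {..<x}"
      using that by auto
    then show ?thesis
      using not_less_Least[OF that[unfolded omega1_def]] by simp
  qed
  ultimately show ?thesis
    by (simp add: otype_omega1_def)
qed

lemma lessThan_omega1_lepoll_continuum: "{..<omega1::'a} \<lesssim> (UNIV :: nat set set)"
  using otype_omega1_lepoll otype_omega1_lessThan_omega1 uncountable_UNIV_nat_set by blast

text \<open>For unboundedness, iterate omega times a function that dominates \<open>h\<close> on
  initial segments and take the supremum, which exists because countable sets are bounded.\<close>

lemma club_closed_under: "club {\<alpha>::'a. closed_under h \<alpha>}"
proof -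
  have "\<exists>\<alpha>\<ge>x. closed_under h \<alpha>" for x :: 'a
  proof -
    have "\<exists>z. y < z \<and> (\<forall>\<xi>\<le>y. h \<xi> < z)" for y :: 'a
    proof -
      obtain y' where y': "y < y'"
        using ex_greater by blast
      obtain z where z: "\<forall>\<xi>\<in>h ` {..<y'}. \<xi> < z"
        using small_bounded_lepoll[OF image_lepoll not_UNIV_lepoll_lessThan] by blast
      have "y < max z y' \<and> (\<forall>\<xi>\<le>y. h \<xi> < max z y')"
        using y' z by (auto simp: less_max_iff_disj)
      then show ?thesis ..
    qed
    then obtain next_pt where next_pt: "\<And>y. y < next_pt y" "\<And>y \<xi>. \<xi> \<le> y \<Longrightarrow> h \<xi> < next_pt y"
      by metis
    define c where "c n = (next_pt ^^ n) x" for n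
    have c_Suc: "c (Suc n) = next_pt (c n)" for n
      by (simp add: c_def)
    obtain b where "\<forall>y\<in>range c. y < b"
      using countable_bounded[of "range c"] by auto
    \<comment> \<open>The supremum of the sequence: any \<xi> below it is at most some
      \<open>c n\<close>, so \<open>h \<xi>\<close> lies below \<open>c (Suc n)\<close>.\<close>
    define \<alpha> where "\<alpha> = (LEAST b. \<forall>n. c n < b)"
    have c_less: "c n < \<alpha>" for n
      using LeastI[of "\<lambda>b. \<forall>n. c n < b" b] \<open>\<forall>y\<in>range c. y < b\<close> by (simp add: \<alpha>_def)
    have "closed_under h \<alpha>"
      unfolding closed_under_def
    proof (intro allI impI)
      fix \<xi> assume "\<xi> < \<alpha>"
      then obtain n where "\<xi> \<le> c n"
        using not_less_Least[of \<xi> "\<lambda>b. \<forall>n. c n < b"] by (auto simp: \<alpha>_def not_less)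
      then have "h \<xi> < c (Suc n)"
        using next_pt c_Suc by simp
      then show "h \<xi> < \<alpha>"
        using c_less less_trans by blast
    qed
    moreover have "x \<le> \<alpha>"
      using c_less[of 0] by (simp add: c_def)
    ultimately show ?thesis
      by blast
  qed
  moreover have "closed_under h \<alpha>"
    if "\<forall>\<beta><\<alpha>. \<exists>\<gamma>. closed_under h \<gamma> \<and> \<beta> < \<gamma> \<and> \<gamma> < \<alpha>" for \<alpha>
    using that unfolding closed_under_def by (meson less_trans)
  ultimately show ?thesis
    unfolding club_def by blast
qed

section \<open>Guessing functions by diamond\<close>

lemma ex_pairing: "\<exists>p :: 'a \<Rightarrow> 'a \<Rightarrow> 'a. \<forall>a b c d. p a b = p c d \<longrightarrow> a = c \<and> b = d"
proof -
  obtain q :: "'a \<times> 'a \<Rightarrow> 'a" where "inj q"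
    using infinite_times_self_eqpoll[OF infinite_UNIV] unfolding eqpoll_def UNIV_Times_UNIV
    by (auto simp: bij_betw_def)
  then have "\<forall>a b c d. q (a, b) = q (c, d) \<longrightarrow> a = c \<and> b = d"
    by (auto dest: injD)
  then show ?thesis
    by (intro exI[of _ "\<lambda>a b. q (a, b)"])
qed

text \<open>A function is coded by the set of its paired graph points. If \<alpha> is closed under
  \<xi> \<mapsto> \<open>p \<xi> (F \<xi>)\<close>, the codes of the graph below \<alpha> lie below
  \<alpha>, so a correct guess of the set there can be decoded to \<open>F\<close>.\<close>

lemma diamond_functions:
  fixes S :: "'a set"
  assumes "diamond S"
  shows "\<exists>G :: 'a \<Rightarrow> 'a \<Rightarrow> 'a. \<forall>F h. \<exists>\<alpha>\<in>S. closed_under h \<alpha> \<and> (\<forall>\<xi><\<alpha>. G \<alpha> \<xi> = F \<xi>)"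
proof -
  obtain p :: "'a \<Rightarrow> 'a \<Rightarrow> 'a" where p: "\<And>a b c d. p a b = p c d \<Longrightarrow> a = c \<and> b = d"
    using ex_pairing by blast
  obtain D :: "'a \<Rightarrow> 'a set" where D: "\<And>X. stationary {\<alpha>\<in>S. X \<inter> {..<\<alpha>} = D \<alpha>}"
    using assms by (auto simp: diamond_def)
  define G where "G \<alpha> \<xi> = (SOME \<eta>. p \<xi> \<eta> \<in> D \<alpha>)" for \<alpha> \<xi>
  have "\<exists>\<alpha>\<in>S. closed_under h \<alpha> \<and> (\<forall>\<xi><\<alpha>. G \<alpha> \<xi> = F \<xi>)" for F h
  proof -
    define X where "X = range (\<lambda>\<xi>. p \<xi> (F \<xi>))"
    have "{\<alpha>\<in>S. X \<inter> {..<\<alpha>} = D \<alpha>} \<inter> {\<alpha>. closed_under (\<lambda>\<xi>. max (h \<xi>) (p \<xi> (F \<xi>))) \<alpha>} \<noteq> {}"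
      using D club_closed_under unfolding stationary_def by blast
    then obtain \<alpha> where \<alpha>: "\<alpha> \<in> S" "D \<alpha> = X \<inter> {..<\<alpha>}" "closed_under h \<alpha>"
      "closed_under (\<lambda>\<xi>. p \<xi> (F \<xi>)) \<alpha>"
      unfolding closed_under_max by blast
    have "G \<alpha> \<xi> = F \<xi>" if "\<xi> < \<alpha>" for \<xi>
    proof -
      have "p \<xi> (F \<xi>) \<in> D \<alpha>"
        using \<alpha>(2,4) that by (auto simp: X_def closed_under_def)
      then have "p \<xi> (G \<alpha> \<xi>) \<in> D \<alpha>"
        unfolding G_def by (rule someI)
      then obtain \<xi>' where "p \<xi> (G \<alpha> \<xi>) = p \<xi>' (F \<xi>')"
        using \<alpha>(2) by (auto simp: X_def)
      then show ?thesis
        using p by blast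
    qed
    then show ?thesis
      using \<alpha> by blast
  qed
  then show ?thesis
    by blast
qed

text \<open>\<open>R\<close> is what a surviving image must satisfy. \<open>k\<close> marks the
  points at which the ladder lies below \<alpha>, where a correct guess of \<open>F\<close>
  determines the image. \<open>h\<close> lets a caller demand closure of the \<alpha> that is found,
  and \<open>R\<close> is checked only there.\<close>

lemma diamond_almost_disjoint_images:
  fixes S :: "'a set" and A :: "'a \<Rightarrow> 'a set" and R :: "'a \<Rightarrow> 'a set \<Rightarrow> bool"
  assumes "diamond S" and ad: "almost_disjoint_seq S A"
    and size: "\<forall>\<alpha>\<in>S. A \<alpha> \<lesssim> (UNIV :: nat set set)"
    and sub: "\<forall>\<alpha>\<in>S. closed_under k \<alpha> \<longrightarrow> A \<alpha> \<subseteq> {..<\<alpha>}"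
  shows "\<exists>S' B. S' \<subseteq> S \<and> almost_disjoint_seq S' B \<and> (\<forall>\<alpha>\<in>S'. R \<alpha> (B \<alpha>)) \<and>
    (\<forall>F h. inj F \<longrightarrow> (\<forall>\<alpha>\<in>S. closed_under h \<alpha> \<longrightarrow> R \<alpha> (F ` A \<alpha>)) \<longrightarrow>
      (\<exists>\<alpha>\<in>S'. closed_under h \<alpha> \<and> B \<alpha> = F ` A \<alpha>))"
proof -
  obtain G :: "'a \<Rightarrow> 'a \<Rightarrow> 'a"
    where G: "\<And>F h. \<exists>\<alpha>\<in>S. closed_under h \<alpha> \<and> (\<forall>\<xi><\<alpha>. G \<alpha> \<xi> = F \<xi>)"
    using diamond_functions[OF \<open>diamond S\<close>] by blast
  define B where "B \<alpha> = G \<alpha> ` A \<alpha>" for \<alpha>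
  \<comment> \<open>The comparison is with all earlier images, not just surviving ones, so the
    definition is not recursive.\<close>
  define S' where "S' = {\<alpha>\<in>S. R \<alpha> (B \<alpha>) \<and> (\<forall>\<beta>\<in>S. \<beta> < \<alpha> \<longrightarrow> finite (B \<alpha> \<inter> B \<beta>))}"
  have "finite (B \<alpha> \<inter> B \<beta>)" if "\<alpha> \<in> S'" "\<beta> \<in> S'" "\<alpha> \<noteq> \<beta>" for \<alpha> \<beta>
    using that by (cases \<alpha> \<beta> rule: linorder_cases) (auto simp: S'_def Int_commute)
  then have "almost_disjoint_seq S' B"
    by (simp add: almost_disjoint_seq_def)
  moreover have "\<exists>\<alpha>\<in>S'. closed_under h \<alpha> \<and> B \<alpha> = F ` A \<alpha>"
    if F: "inj F" and RF: "\<And>\<alpha>. \<alpha> \<in> S \<Longrightarrow> closed_under h \<alpha> \<Longrightarrow> R \<alpha> (F ` A \<alpha>)" for F h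
  proof (rule ccontr)
    assume none: "\<not> ?thesis"
    define U where "U = {\<alpha>\<in>S. closed_under h \<alpha> \<and> closed_under k \<alpha> \<and> (\<forall>\<xi><\<alpha>. G \<alpha> \<xi> = F \<xi>)}"
    have B_eq: "B \<alpha> = F ` A \<alpha>" if "\<alpha> \<in> U" for \<alpha>
      unfolding B_def using that sub by (intro image_cong) (auto simp: U_def)
    \<comment> \<open>Correct guesses in \<open>U\<close> satisfy \<open>R\<close> but do not
      survive, so an earlier image must be the obstacle.\<close>
    have meets: "\<exists>\<beta>\<in>S. \<beta> < \<alpha> \<and> infinite (B \<alpha> \<inter> B \<beta>)" if "\<alpha> \<in> U" for \<alpha>
    proof -
      have "\<alpha> \<notin> S'"
        using none that B_eq unfolding U_def by blast
      then show ?thesis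
        using that B_eq[OF that] RF[of \<alpha>] by (auto simp: S'_def U_def)
    qed
    have "\<exists>y. \<forall>\<alpha>\<in>U. infinite (B \<alpha> \<inter> B \<beta>) \<longrightarrow> \<alpha> < y" if "\<beta> \<in> S" for \<beta>
    proof -
      \<comment> \<open>Injectivity of \<open>F\<close> carries almost disjointness from the ladders
        to their images. Hence at most continuum many of them meet the fixed
        \<open>B \<beta>\<close> infinitely, and their indices are bounded.\<close>
      have "{\<alpha>\<in>U. infinite (B \<alpha> \<inter> B \<beta>)} \<lesssim> (UNIV :: nat set set)"
      proof (rule almost_disjoint_infinite_traces_lepoll)
        show "B \<beta> \<lesssim> (UNIV :: nat set set)"
          unfolding B_def using image_lepoll bspec[OF size that] lepoll_trans by blast
        fix \<alpha> \<alpha>'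
        assume "\<alpha> \<in> {\<alpha>\<in>U. infinite (B \<alpha> \<inter> B \<beta>)}" "\<alpha>' \<in> {\<alpha>\<in>U. infinite (B \<alpha> \<inter> B \<beta>)}" "\<alpha> \<noteq> \<alpha>'"
        then have "B \<alpha> \<inter> B \<alpha>' = F ` (A \<alpha> \<inter> A \<alpha>')" "finite (A \<alpha> \<inter> A \<alpha>')"
          using B_eq F ad by (auto simp: image_Int U_def almost_disjoint_seq_def)
        then show "finite (B \<alpha> \<inter> B \<alpha>')"
          by simp
      qed auto
      then show ?thesis
        using small_bounded_lepoll[OF _ not_UNIV_lepoll_continuum] by fastforce
    qed
    \<comment> \<open>Fodor's argument: a closure point of \<open>g\<close> in \<open>U\<close> has no such \<open>\<beta>\<close> below it.\<close>
    then obtain g where g: "\<And>\<alpha> \<beta>. \<beta> \<in> S \<Longrightarrow> \<alpha> \<in> U \<Longrightarrow> infinite (B \<alpha> \<inter> B \<beta>) \<Longrightarrow> \<alpha> < g \<beta>"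
      by metis
    obtain \<alpha> where "\<alpha> \<in> S" "closed_under (\<lambda>\<xi>. max (h \<xi>) (max (k \<xi>) (g \<xi>))) \<alpha>"
      "\<forall>\<xi><\<alpha>. G \<alpha> \<xi> = F \<xi>"
      using G by blast
    then have \<alpha>: "\<alpha> \<in> U" "closed_under g \<alpha>"
      by (auto simp: U_def closed_under_max)
    then obtain \<beta> where \<beta>: "\<beta> \<in> S" "\<beta> < \<alpha>" "infinite (B \<alpha> \<inter> B \<beta>)"
      using meets by blast
    then have "\<alpha> < g \<beta>" "g \<beta> < \<alpha>"
      using g \<alpha> by (auto simp: closed_under_def)
    then show False
      by simp
  qed
  ultimately show ?thesis
    by (intro exI[of _ S'] exI[of _ B]) (auto simp: S'_def)
qed

section \<open>The clubsuit sequence and the systems\<close>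

text \<open>Transfinite recursion along \<lambda>: before stage n fewer than \<lambda> values of
  \<open>\<pi>\<close> are taken, so they are bounded, and \<open>Y n\<close> has a point beyond
  them.\<close>

lemma injective_system_of_representatives:
  fixes \<pi> :: "'b \<Rightarrow> 'a" and Y :: "'a \<Rightarrow> 'b set"
  assumes Y: "\<And>n x. \<exists>y\<in>Y n. x \<le> \<pi> y"
  shows "\<exists>F. inj (\<pi> \<circ> F) \<and> (\<forall>n. F n \<in> Y n)"
proof -
  have "\<exists>F. \<forall>n. F n \<in> Y n \<and> \<pi> (F n) \<notin> (\<pi> \<circ> F) ` {..<n}"
  proof (rule dependent_wellorder_choice)
    fix n :: 'a and F
    obtain x where "\<forall>y\<in>(\<pi> \<circ> F) ` {..<n}. y < x"
      using small_bounded_lepoll[OF image_lepoll not_UNIV_lepoll_lessThan] by blast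
    moreover obtain y where "y \<in> Y n" "x \<le> \<pi> y"
      using Y by blast
    ultimately show "\<exists>r. r \<in> Y n \<and> \<pi> r \<notin> (\<pi> \<circ> F) ` {..<n}"
      by (intro exI[of _ y]) (auto simp: not_less[symmetric])
  qed auto
  then obtain F where F: "\<And>n. F n \<in> Y n \<and> \<pi> (F n) \<notin> (\<pi> \<circ> F) ` {..<n}"
    by blast
  have "inj (\<pi> \<circ> F)"
  proof (rule injI)
    fix m n assume eq: "(\<pi> \<circ> F) m = (\<pi> \<circ> F) n"
    have "\<not> n < m" "\<not> m < n"
      using F[of m] F[of n] eq by (metis comp_apply image_eqI lessThan_iff)+
    then show "m = n"
      by simp
  qed
  then show ?thesis
    using F by blast
qed

lemma almost_disjoint_clubsuit:
  fixes S :: "'a set"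
  assumes "bigstar S" "diamond S"
  shows "\<exists>S'\<subseteq>S. \<exists>B. clubsuit_seq S' B \<and> almost_disjoint_seq S' B \<and>
    (\<forall>\<alpha>\<in>S'. B \<alpha> \<approx> {..<omega1::'a})"
proof -
  obtain A where A: "\<And>\<alpha>. \<alpha> \<in> S \<Longrightarrow> cofinal_in (A \<alpha>) \<alpha> \<and> otype_omega1 (A \<alpha>)"
    and ad: "almost_disjoint_seq S A"
    using assms(1) unfolding bigstar_def almost_disjoint_seq_def by blast
  have small: "\<forall>\<alpha>\<in>S. A \<alpha> \<lesssim> (UNIV :: nat set set)"
    using A otype_omega1_lepoll uncountable_UNIV_nat_set by blast
  \<comment> \<open>Every \<alpha> is closed under \<open>id\<close>, so this covers all of
    \<open>S\<close>.\<close>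
  have below: "\<forall>\<alpha>\<in>S. closed_under id \<alpha> \<longrightarrow> A \<alpha> \<subseteq> {..<\<alpha>}"
    using A by (simp add: cofinal_in_def)
  obtain S' B where S': "S' \<subseteq> S" "almost_disjoint_seq S' B"
    and B: "\<forall>\<alpha>\<in>S'. cofinal_in (B \<alpha>) \<alpha> \<and> B \<alpha> \<approx> {..<omega1::'a}"
    and guess: "\<forall>F h. inj F \<longrightarrow> (\<forall>\<alpha>\<in>S. closed_under h \<alpha> \<longrightarrow>
        cofinal_in (F ` A \<alpha>) \<alpha> \<and> F ` A \<alpha> \<approx> {..<omega1::'a}) \<longrightarrow>
        (\<exists>\<alpha>\<in>S'. closed_under h \<alpha> \<and> B \<alpha> = F ` A \<alpha>)"
    using diamond_almost_disjoint_images[OF assms(2) ad small below,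
        where R = "\<lambda>\<alpha> B. cofinal_in B \<alpha> \<and> B \<approx> {..<omega1::'a}"]
    by (elim exE conjE) (rule that)
  have "\<exists>\<alpha>\<in>S'. B \<alpha> \<subseteq> X" if X: "\<exists>f. bij_betw f X (UNIV :: 'a set)" for X :: "'a set"
  proof -
    obtain F :: "'a \<Rightarrow> 'a" where F: "inj F" "range F = X"
      using X bij_betw_inv_into by (metis bij_betw_def)
    \<comment> \<open>Being injective, \<open>F\<close> sends fewer than \<lambda> points below
      \<delta>. The resulting bound \<open>g \<delta>\<close> makes \<open>F\<close> at least
      \<delta> from there on, so at a closure point of \<open>g\<close> the image of a cofinal
      ladder stays cofinal.\<close>
    have "\<exists>y. \<forall>\<xi>\<in>F -` {..<\<delta>}. \<xi> < y" for \<delta>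
    proof (rule small_bounded_lepoll)
      show "F -` {..<\<delta>} \<lesssim> {..<\<delta>}"
        using F(1) by (auto simp: lepoll_def intro!: exI[of _ F] inj_on_subset[of F UNIV])
    qed (rule not_UNIV_lepoll_lessThan)
    then obtain g where g: "\<And>\<delta> \<xi>. F \<xi> < \<delta> \<Longrightarrow> \<xi> < g \<delta>"
      by (metis lessThan_iff vimageI)
    have "cofinal_in (F ` A \<alpha>) \<alpha> \<and> F ` A \<alpha> \<approx> {..<omega1::'a}"
      if \<alpha>: "\<alpha> \<in> S" "closed_under (\<lambda>\<xi>. max (F \<xi>) (g \<xi>)) \<alpha>" for \<alpha>
    proof
      have F_less: "\<And>\<xi>. \<xi> < \<alpha> \<Longrightarrow> F \<xi> < \<alpha>" and g_less: "\<And>\<xi>. \<xi> < \<alpha> \<Longrightarrow> g \<xi> < \<alpha>"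
        using \<alpha>(2) by (auto simp: closed_under_def)
      have A\<alpha>: "A \<alpha> \<subseteq> {..<\<alpha>}" "\<And>\<beta>. \<beta> < \<alpha> \<Longrightarrow> \<exists>\<gamma>\<in>A \<alpha>. \<beta> \<le> \<gamma>"
        using A[OF \<alpha>(1)] by (auto simp: cofinal_in_def)
      show "cofinal_in (F ` A \<alpha>) \<alpha>"
        unfolding cofinal_in_def
      proof (intro conjI allI impI)
        show "F ` A \<alpha> \<subseteq> {..<\<alpha>}"
          using A\<alpha>(1) F_less by auto
        fix \<beta> assume "\<beta> < \<alpha>"
        then obtain \<gamma> where "\<gamma> \<in> A \<alpha>" "g \<beta> \<le> \<gamma>"
          using A\<alpha>(2) g_less by blast
        then show "\<exists>\<gamma>\<in>F ` A \<alpha>. \<beta> \<le> \<gamma>"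
          using g[of \<gamma> \<beta>] by (meson imageI leD not_less)
      qed
      show "F ` A \<alpha> \<approx> {..<omega1::'a}"
        using A[OF \<alpha>(1)] otype_omega1_eqpoll[OF _ otype_omega1_lessThan_omega1]
          inj_on_image_eqpoll_self[OF inj_on_subset[OF F(1) subset_UNIV]] eqpoll_trans by blast
    qed
    then show ?thesis
      using guess[rule_format, OF F(1), of "\<lambda>\<xi>. max (F \<xi>) (g \<xi>)"] F(2)
      by (metis image_mono subset_UNIV)
  qed
  then show ?thesis
    using S' B unfolding clubsuit_seq_def by blast
qed

section \<open>Colourings of systems\<close>

lemma omega_system_infinite:
  assumes "omega_system \<A> L K" "A \<in> \<A>" "infinite K"
  shows "infinite A"
  using assms bij_betw_finite unfolding omega_system_def by metis

text \<open>The union of \<lambda> sets of size omega_1 has size at most \<lambda>, so it has an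
  injective colouring, which serves both purposes.\<close>

lemma omega1_system_colorable:
  assumes "omega_system \<A> (UNIV :: 'a set) {..<(omega1::'a)}"
  shows "colorable_by \<A> (UNIV :: 'a set) \<and> cf_colorable_by \<A> (UNIV :: 'a set)"
proof -
  have inf: "infinite A" if "A \<in> \<A>" for A
    using omega_system_infinite[OF assms that] otype_omega1_lessThan_omega1
    by (simp add: otype_omega1_def uncountable_infinite)
  have "\<A> \<lesssim> (UNIV :: 'a set)"
    using assms by (intro eqpoll_imp_lepoll) (simp add: omega_system_def eqpoll_def)
  moreover have "A \<lesssim> (UNIV :: 'a set)" if "A \<in> \<A>" for A
  proof -
    have "A \<approx> {..<omega1::'a}"
      using assms that by (simp add: omega_system_def eqpoll_def)
    then show ?thesis
      by (rule lepoll_trans1) (simp add: subset_imp_lepoll)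
  qed
  ultimately have "(\<Union>A\<in>\<A>. A) \<lesssim> (UNIV :: 'a set)"
    by (intro UN_lepoll_infinite infinite_UNIV)
  then obtain f :: "_ \<Rightarrow> 'a" where f: "inj_on f (\<Union>\<A>)"
    by (auto simp: lepoll_def)
  have "\<exists>x\<in>A. \<exists>y\<in>A. f x \<noteq> f y" "\<exists>z. \<exists>!x. x \<in> A \<and> f x = z" if A: "A \<in> \<A>" for A
  proof -
    obtain x where x: "x \<in> A"
      using inf[OF A] infinite_imp_nonempty by blast
    obtain y where y: "y \<in> A - {x}"
      using inf[OF A] infinite_imp_nonempty[of "A - {x}"] by auto
    have eq: "z = x" if "z \<in> A" "f z = f x" for z
      using inj_onD[OF f that(2)] A x that by blast
    show "\<exists>x\<in>A. \<exists>y\<in>A. f x \<noteq> f y"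
      using x y eq[of y] by (intro bexI[of _ x] bexI[of _ y]) auto
    show "\<exists>z. \<exists>!x. x \<in> A \<and> f x = z"
      using x eq by (intro exI[of _ "f x"] ex1I[of _ x]) auto
  qed
  then show ?thesis
    unfolding colorable_by_def cf_colorable_by_def by (intro conjI exI[of _ f]) auto
qed

text \<open>An infinite member has a point besides the one with a unique colour. This transfers
  lower bounds from ordinary to conflict-free colourings.\<close>

lemma cf_colorable_imp_colorable:
  assumes "omega_system \<A> L K" "infinite K" "cf_colorable_by \<A> R"
  shows "colorable_by \<A> R"
proof -
  obtain f where f: "f ` \<Union>\<A> \<subseteq> R" "\<forall>A\<in>\<A>. \<exists>z. \<exists>!x. x \<in> A \<and> f x = z"
    using assms(3) unfolding cf_colorable_by_def by (elim exE conjE)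
  have "\<exists>x\<in>A. \<exists>y\<in>A. f x \<noteq> f y" if A: "A \<in> \<A>" for A
  proof -
    obtain x where x: "x \<in> A" "\<And>y. y \<in> A \<Longrightarrow> f y = f x \<Longrightarrow> y = x"
      using bspec[OF f(2) A] by auto
    have "infinite (A - {x})"
      using omega_system_infinite[OF assms(1) A assms(2)] by simp
    then obtain y where "y \<in> A - {x}"
      using infinite_imp_nonempty by blast
    then show ?thesis
      using x by (metis DiffE insertI1)
  qed
  then show ?thesis
    using f(1) unfolding colorable_by_def by blast
qed

text \<open>An unbounded colour class would contain some \<open>B \<alpha>\<close>, which would then
  be monochromatic. So each of the fewer than \<lambda> classes is bounded, hence all have a common
  bound, yet some \<open>B \<alpha>\<close> lies entirely above it.\<close>

lemma clubsuit_system: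
  fixes S :: "'a set"
  assumes club: "clubsuit_seq S B" and ad: "almost_disjoint_seq S B"
    and size: "\<And>\<alpha>. \<alpha> \<in> S \<Longrightarrow> B \<alpha> \<approx> K" and K: "infinite K"
  shows "omega_system (B ` S) (UNIV :: 'a set) K" "\<not> colorable_by (B ` S) {..<r::'a}"
proof -
  have inf: "infinite (B \<alpha>)" if "\<alpha> \<in> S" for \<alpha>
    using size[OF that] K eqpoll_finite_iff by blast
  have sub: "B \<alpha> \<subseteq> {..<\<alpha>}" if "\<alpha> \<in> S" for \<alpha>
    using club that by (simp add: clubsuit_seq_def cofinal_in_def)
  have guess: "\<exists>\<alpha>\<in>S. B \<alpha> \<subseteq> X" if "\<And>x. \<exists>y\<in>X. x \<le> y" for X
    using unbounded_eqpoll[OF that] club by (auto simp: clubsuit_seq_def eqpoll_def)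
  \<comment> \<open>Guessing the tails shows that \<open>S\<close> is unbounded, hence of size
    \<lambda>, and later gives a member above all colour classes.\<close>
  have above: "\<exists>\<alpha>\<in>S. B \<alpha> \<subseteq> {x<..}" for x
    by (rule guess) (metis ex_greater greaterThan_iff less_imp_le max.cobounded1 less_max_iff_disj)
  have "\<exists>\<alpha>\<in>S. x \<le> \<alpha>" for x
  proof -
    obtain \<alpha> where \<alpha>: "\<alpha> \<in> S" "B \<alpha> \<subseteq> {x<..}"
      using above by blast
    then obtain y where "y \<in> B \<alpha>"
      using inf infinite_imp_nonempty by blast
    then have "x < \<alpha>"
      using \<alpha> sub[of \<alpha>] by force
    then show ?thesis
      using \<alpha>(1) by (intro bexI[of _ \<alpha>]) auto
  qed
  then have "S \<approx> (UNIV :: 'a set)"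
    by (rule unbounded_eqpoll)
  moreover have "inj_on B S"
    using inf ad by (intro inj_onI) (metis Int_absorb almost_disjoint_seq_def)
  ultimately have "B ` S \<approx> (UNIV :: 'a set)"
    by simp
  then show "omega_system (B ` S) (UNIV :: 'a set) K"
    using size ad unfolding omega_system_def almost_disjoint_seq_def eqpoll_def by auto
  show "\<not> colorable_by (B ` S) {..<r}"
  proof
    assume "colorable_by (B ` S) {..<r}"
    then obtain f where f: "f ` \<Union>(B ` S) \<subseteq> {..<r}"
      "\<forall>A\<in>B ` S. \<exists>x\<in>A. \<exists>y\<in>A. f x \<noteq> f y"
      unfolding colorable_by_def by (elim exE conjE)
    define X where "X z = {x\<in>\<Union>(B ` S). f x = z}" for z :: 'a
    have "\<exists>b. \<forall>y\<in>X z. y < b" for z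
    proof (rule ccontr)
      assume "\<not> ?thesis"
      then obtain \<alpha> where \<alpha>: "\<alpha> \<in> S" "B \<alpha> \<subseteq> X z"
        using guess[of "X z"] by (meson not_less)
      then show False
        using bspec[OF f(2) imageI[OF \<alpha>(1)]] by (auto simp: X_def)
    qed
    then obtain b where b: "\<And>z y. y \<in> X z \<Longrightarrow> y < b z"
      by metis
    obtain c where c: "\<And>z. z < r \<Longrightarrow> b z < c"
      using small_bounded_lepoll[OF image_lepoll not_UNIV_lepoll_lessThan, of b r] by auto
    obtain \<alpha> where \<alpha>: "\<alpha> \<in> S" "B \<alpha> \<subseteq> {c<..}"
      using above by blast
    then obtain y where y: "y \<in> B \<alpha>"
      using inf infinite_imp_nonempty by blast
    then have "y < b (f y)" "b (f y) < c" "c < y"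
      using b[of y "f y"] c[of "f y"] f(1) \<alpha> by (auto simp: X_def)
    then show False
      by simp
  qed
qed

text \<open>\<open>M\<close> is split into \<lambda> disjoint blocks of size |K|; member \<alpha> is
  block \<alpha> together with the surviving image at \<alpha>, if any. A correct guess makes some
  member repeat each of its colours.\<close>

lemma not_cf_colorable_system:
  fixes S K :: "'a set"
  assumes star: "bigstar S" and dia: "diamond S"
    and K: "infinite K" "{..<omega1::'a} \<lesssim> K"
  shows "\<exists>\<A>::'a set set. omega_system \<A> (UNIV::'a set) K \<and>
    \<not> cf_colorable_by \<A> {..<omega1::'a}"
proof -
  obtain A where A: "\<And>\<alpha>. \<alpha> \<in> S \<Longrightarrow> cofinal_in (A \<alpha>) \<alpha> \<and> otype_omega1 (A \<alpha>)"
    and ad: "almost_disjoint_seq S A"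
    using star unfolding bigstar_def almost_disjoint_seq_def by blast
  obtain p :: "'a \<Rightarrow> 'a \<Rightarrow> 'a" where p: "\<And>a b c d. p a b = p c d \<longleftrightarrow> a = c \<and> b = d"
    using ex_pairing by (metis (no_types))
  \<comment> \<open>The pairing serves twice: block points pair a block index with an element of
    \<open>K\<close>, and ladder points are later paired with labels. \<open>\<pi>\<close> and
    \<open>\<rho>\<close> read off the coordinates of a pair.\<close>
  define \<pi> where "\<pi> x = (THE a. \<exists>b. x = p a b)" for x
  define \<rho> where "\<rho> x = (THE b. \<exists>a. x = p a b)" for x
  have \<pi>: "\<pi> (p a b) = a" and \<rho>: "\<rho> (p a b) = b" for a b
    by (simp_all add: \<pi>_def \<rho>_def p)
  define P where "P \<alpha> = p \<alpha> ` K" for \<alpha>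
  define M where "M = (\<Union>\<alpha>. P \<alpha>)"
  have P_eqpoll: "P \<alpha> \<approx> K" for \<alpha>
    unfolding P_def by (rule inj_on_image_eqpoll_self) (auto simp: inj_on_def p)
  \<comment> \<open>Labels come from a bijection of the ladder with omega_1 \<times> omega_1: the
    first coordinate is the label, and two second coordinates u \<noteq> v make it occur
    twice.\<close>
  have "\<exists>c. c ` A \<alpha> \<subseteq> {..<omega1::'a} \<and>
      (\<forall>\<zeta><omega1. \<exists>a\<in>A \<alpha>. \<exists>b\<in>A \<alpha>. a \<noteq> b \<and> c a = \<zeta> \<and> c b = \<zeta>)" if "\<alpha> \<in> S" for \<alpha>
  proof -
    let ?W = "{..<omega1::'a}"
    have W: "infinite ?W"
      using otype_omega1_lessThan_omega1 by (simp add: otype_omega1_def uncountable_infinite)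
    have "A \<alpha> \<approx> ?W \<times> ?W"
      using A that otype_omega1_eqpoll otype_omega1_lessThan_omega1
        infinite_times_self_eqpoll[OF W] eqpoll_sym eqpoll_trans by blast
    then obtain e where e: "bij_betw e (A \<alpha>) (?W \<times> ?W)"
      by (auto simp: eqpoll_def)
    obtain u v where uv: "u \<in> ?W" "v \<in> ?W" "u \<noteq> v"
      using W by (metis finite.simps finite_insert insertI1 subsetI subset_singletonD)
    have "\<exists>a\<in>A \<alpha>. \<exists>b\<in>A \<alpha>. a \<noteq> b \<and> fst (e a) = \<zeta> \<and> fst (e b) = \<zeta>" if "\<zeta> < omega1" for \<zeta>
    proof -
      have "(\<zeta>, u) \<in> e ` A \<alpha>" "(\<zeta>, v) \<in> e ` A \<alpha>"
        using e uv that by (auto simp: bij_betw_def)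
      then obtain a b where "a \<in> A \<alpha>" "b \<in> A \<alpha>" "e a = (\<zeta>, u)" "e b = (\<zeta>, v)"
        by (metis imageE)
      then show ?thesis
        using uv(3) by (metis fst_conv snd_conv)
    qed
    moreover have "(fst \<circ> e) ` A \<alpha> \<subseteq> ?W"
      using bij_betw_apply[OF e] by (auto simp: mem_Times_iff)
    ultimately show ?thesis
      by (intro exI[of _ "fst \<circ> e"]) auto
  qed
  then obtain c where c: "\<And>\<alpha>. \<alpha> \<in> S \<Longrightarrow> c \<alpha> ` A \<alpha> \<subseteq> {..<omega1::'a}"
    and twice: "\<And>\<alpha> \<zeta>. \<alpha> \<in> S \<Longrightarrow> \<zeta> < omega1 \<Longrightarrow>
      \<exists>a\<in>A \<alpha>. \<exists>b\<in>A \<alpha>. a \<noteq> b \<and> c \<alpha> a = \<zeta> \<and> c \<alpha> b = \<zeta>"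
    by metis
  \<comment> \<open>The code of a ladder point carries its label, so that \<open>F\<close> can
    choose a colour from it. Equal codes have equal ladder points, which keeps the family almost
    disjoint.\<close>
  define A' where "A' \<alpha> = (\<lambda>a. p a (c \<alpha> a)) ` A \<alpha>" for \<alpha>
  have ad': "almost_disjoint_seq S A'"
    unfolding almost_disjoint_seq_def
  proof (intro ballI impI)
    fix \<alpha> \<beta> assume "\<alpha> \<in> S" "\<beta> \<in> S" "\<alpha> \<noteq> \<beta>"
    then have "finite (A \<alpha> \<inter> A \<beta>)"
      using ad by (simp add: almost_disjoint_seq_def)
    moreover have "A' \<alpha> \<inter> A' \<beta> \<subseteq> (\<lambda>a. p a (c \<alpha> a)) ` (A \<alpha> \<inter> A \<beta>)"
      by (auto simp: A'_def p)
    ultimately show "finite (A' \<alpha> \<inter> A' \<beta>)"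
      using finite_surj by blast
  qed
  have size': "A' \<alpha> \<lesssim> {..<omega1::'a}" if "\<alpha> \<in> S" for \<alpha>
    unfolding A'_def using A[OF that] image_lepoll lepoll_trans otype_omega1_lepoll
      otype_omega1_lessThan_omega1 by (metis otype_omega1_def)
  \<comment> \<open>The bound \<open>q \<xi>\<close> is uniform in the label, so at closure points
    of \<open>q\<close> the coded ladder stays below \<alpha>.\<close>
  have "\<exists>y. \<forall>\<zeta>\<in>{..<omega1}. p \<xi> \<zeta> < y" for \<xi>
    using small_bounded_lepoll[OF image_lepoll not_UNIV_lepoll_lessThan, of "p \<xi>" omega1] by auto
  then obtain q where q: "\<And>\<xi> \<zeta>. \<zeta> < omega1 \<Longrightarrow> p \<xi> \<zeta> < q \<xi>"
    by (metis lessThan_iff)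
  have small: "\<forall>\<alpha>\<in>S. A' \<alpha> \<lesssim> (UNIV :: nat set set)"
    using size' lessThan_omega1_lepoll_continuum lepoll_trans by blast
  have below: "\<forall>\<alpha>\<in>S. closed_under q \<alpha> \<longrightarrow> A' \<alpha> \<subseteq> {..<\<alpha>}"
  proof (intro ballI impI)
    fix \<alpha> assume "\<alpha> \<in> S" "closed_under q \<alpha>"
    have "p a (c \<alpha> a) < \<alpha>" if "a \<in> A \<alpha>" for a
    proof -
      have "a < \<alpha>" "c \<alpha> a < omega1"
        using A[OF \<open>\<alpha> \<in> S\<close>] c[OF \<open>\<alpha> \<in> S\<close>] that by (auto simp: cofinal_in_def)
      then show ?thesis
        using q[of "c \<alpha> a" a] \<open>closed_under q \<alpha>\<close> by (auto simp: closed_under_def intro: less_trans)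
    qed
    then show "A' \<alpha> \<subseteq> {..<\<alpha>}"
      by (auto simp: A'_def)
  qed
  \<comment> \<open>Here \<open>R\<close> asks for images inside \<open>M\<close> that meet each
    block at most once and have size at most omega_1. The second condition keeps images almost
    disjoint from blocks, the third keeps the members of size |K|.\<close>
  obtain S' B where S': "S' \<subseteq> S" and adB: "almost_disjoint_seq S' B"
    and B: "\<forall>\<alpha>\<in>S'. B \<alpha> \<subseteq> M \<and> inj_on \<pi> (B \<alpha>) \<and> B \<alpha> \<lesssim> {..<omega1::'a}"
    and guess: "\<forall>F h. inj F \<longrightarrow> (\<forall>\<alpha>\<in>S. closed_under h \<alpha> \<longrightarrow>
        F ` A' \<alpha> \<subseteq> M \<and> inj_on \<pi> (F ` A' \<alpha>) \<and> F ` A' \<alpha> \<lesssim> {..<omega1::'a}) \<longrightarrow>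
        (\<exists>\<alpha>\<in>S'. closed_under h \<alpha> \<and> B \<alpha> = F ` A' \<alpha>)"
    using diamond_almost_disjoint_images[OF dia ad' small below,
        where R = "\<lambda>\<alpha> B. B \<subseteq> M \<and> inj_on \<pi> B \<and> B \<lesssim> {..<omega1::'a}"]
    by (elim exE conjE) (rule that)
  define Q where "Q \<alpha> = P \<alpha> \<union> (if \<alpha> \<in> S' then B \<alpha> else {})" for \<alpha>
  have Q_eqpoll: "Q \<alpha> \<approx> K" for \<alpha>
  proof (rule lepoll_antisym)
    have "(if \<alpha> \<in> S' then B \<alpha> else {}) \<lesssim> K"
      using bspec[OF B, of \<alpha>] lepoll_trans[OF _ K(2)] by auto
    then show "Q \<alpha> \<lesssim> K"
      unfolding Q_def by (rule Un_lepoll_infinite[OF K(1) eqpoll_imp_lepoll[OF P_eqpoll]])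
    show "K \<lesssim> Q \<alpha>"
      using eqpoll_sym[OF P_eqpoll] by (rule lepoll_trans1) (auto simp: Q_def subset_imp_lepoll)
  qed
  have BP: "finite (B \<alpha> \<inter> P \<beta>)" if "\<alpha> \<in> S'" for \<alpha> \<beta>
  proof (rule finite_subset)
    show "B \<alpha> \<inter> P \<beta> \<subseteq> {THE x. x \<in> B \<alpha> \<and> \<pi> x = \<beta>}"
    proof
      fix x assume "x \<in> B \<alpha> \<inter> P \<beta>"
      then have "x \<in> B \<alpha> \<and> \<pi> x = \<beta>"
        by (auto simp: P_def \<pi>)
      then have "(THE x. x \<in> B \<alpha> \<and> \<pi> x = \<beta>) = x"
        using bspec[OF B that] by (intro the_equality) (auto dest: inj_onD)
      then show "x \<in> {THE x. x \<in> B \<alpha> \<and> \<pi> x = \<beta>}"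
        by simp
    qed
  qed simp
  have Q_finite: "finite (Q \<alpha> \<inter> Q \<beta>)" if "\<alpha> \<noteq> \<beta>" for \<alpha> \<beta>
  proof -
    have "P \<alpha> \<inter> P \<beta> = {}"
      using that by (auto simp: P_def p)
    moreover have "finite (B \<alpha> \<inter> B \<beta>)" if "\<alpha> \<in> S'" "\<beta> \<in> S'"
      using adB that \<open>\<alpha> \<noteq> \<beta>\<close> by (simp add: almost_disjoint_seq_def)
    ultimately show ?thesis
      using BP[of \<alpha> \<beta>] BP[of \<beta> \<alpha>] by (auto simp: Q_def Int_Un_distrib Int_Un_distrib2 Int_commute)
  qed
  have "inj Q"
  proof (rule injI, rule ccontr)
    fix \<alpha> \<beta> assume "Q \<alpha> = Q \<beta>" "\<alpha> \<noteq> \<beta>"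
    then have "finite (Q \<alpha>)"
      using Q_finite[of \<alpha> \<beta>] by simp
    then show False
      using Q_eqpoll[of \<alpha>] K(1) eqpoll_finite_iff by blast
  qed
  then have "range Q \<approx> (UNIV :: 'a set)"
    by (rule inj_on_image_eqpoll_self)
  then have "omega_system (range Q) (UNIV :: 'a set) K"
    using Q_eqpoll unfolding omega_system_def eqpoll_def by (auto intro!: Q_finite)
  moreover have "\<not> cf_colorable_by (range Q) {..<omega1::'a}"
  proof
    assume "cf_colorable_by (range Q) {..<omega1::'a}"
    then obtain f where f: "f ` \<Union>(range Q) \<subseteq> {..<omega1::'a}"
      and unique: "\<forall>A\<in>range Q. \<exists>z. \<exists>!x. x \<in> A \<and> f x = z"
      unfolding cf_colorable_by_def by (elim exE conjE)
    have f_less: "f x < omega1" if "x \<in> P \<alpha>" for x \<alpha>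
      using f that by (auto simp: Q_def)
    define X where "X \<zeta> = {x\<in>M. f x = \<zeta>}" for \<zeta>
    \<comment> \<open>Big colours are those occurring in unboundedly many blocks.\<close>
    define big where "big \<zeta> \<longleftrightarrow> (\<forall>x. \<exists>y\<in>X \<zeta>. x \<le> \<pi> y)" for \<zeta>
    have "\<exists>b. \<not> big \<zeta> \<longrightarrow> (\<forall>y\<in>X \<zeta>. \<pi> y < b)" for \<zeta>
      unfolding big_def by (meson not_less)
    then obtain b where b: "\<And>\<zeta> y. \<not> big \<zeta> \<Longrightarrow> y \<in> X \<zeta> \<Longrightarrow> \<pi> y < b \<zeta>"
      by metis
    \<comment> \<open>Only omega_1 many bounds \<open>b \<zeta>\<close> are involved, so regularity
      bounds them together; from block \<delta> on, only big colours occur.\<close>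
    obtain \<delta> where \<delta>: "\<And>\<zeta>. \<zeta> < omega1 \<Longrightarrow> b \<zeta> < \<delta>"
      using small_bounded_lepoll[OF image_lepoll not_UNIV_lepoll_lessThan, of b omega1] by auto
    have big_P: "big (f x)" if "x \<in> P \<alpha>" "\<delta> \<le> \<alpha>" for x \<alpha>
    proof (rule ccontr)
      assume "\<not> big (f x)"
      moreover have "x \<in> X (f x)" "\<pi> x = \<alpha>"
        using that by (auto simp: X_def M_def P_def \<pi>)
      ultimately have "\<alpha> < b (f x)"
        using b by blast
      also have "\<dots> < \<delta>"
        using \<delta> f_less that by blast
      finally show False
        using that by simp
    qed
    obtain x\<^sub>0 where "x\<^sub>0 \<in> P \<delta>"
      using K(1) unfolding P_def by fastforce
    then have big_0: "big (f x\<^sub>0)"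
      using big_P by blast
    \<comment> \<open>Colours that are not big are replaced by the default
      \<open>f x\<^sub>0\<close>, which is big because its block is \<delta>. Thus every class
      \<open>X (u \<zeta>)\<close> reaches unboundedly many blocks.\<close>
    define u where "u \<zeta> = (if big \<zeta> then \<zeta> else f x\<^sub>0)" for \<zeta>
    have "big (u \<zeta>)" for \<zeta>
      using big_0 by (simp add: u_def)
    \<comment> \<open>\<open>F\<close> maps a ladder point labelled \<zeta> to a point of colour
      \<open>u \<zeta>\<close>, always in a new block.\<close>
    then have "\<exists>F. inj (\<pi> \<circ> F) \<and> (\<forall>n. F n \<in> X (u (\<rho> n)))"
      by (intro injective_system_of_representatives) (auto simp: big_def)
    then obtain F where \<pi>F: "inj (\<pi> \<circ> F)" and F: "\<And>n. F n \<in> X (u (\<rho> n))"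
      by blast
    have "inj F"
      using \<pi>F inj_on_imageI2 by blast
    moreover have "F ` A' \<alpha> \<subseteq> M \<and> inj_on \<pi> (F ` A' \<alpha>) \<and> F ` A' \<alpha> \<lesssim> {..<omega1::'a}"
      if "\<alpha> \<in> S" for \<alpha>
    proof (intro conjI)
      show "F ` A' \<alpha> \<subseteq> M"
        using F by (auto simp: X_def)
      show "inj_on \<pi> (F ` A' \<alpha>)"
        using \<pi>F by (auto simp: inj_on_def)
      show "F ` A' \<alpha> \<lesssim> {..<omega1::'a}"
        using size'[OF that] image_lepoll lepoll_trans by blast
    qed
    ultimately obtain \<alpha> where \<alpha>: "\<alpha> \<in> S'" "closed_under (\<lambda>_. \<delta>) \<alpha>" "B \<alpha> = F ` A' \<alpha>"
      using guess[rule_format, of F "\<lambda>_. \<delta>"] by blast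
    have "\<alpha> \<in> S"
      using \<alpha> S' by blast
    then have "A \<alpha> \<noteq> {}" "A \<alpha> \<subseteq> {..<\<alpha>}"
      using A[OF \<open>\<alpha> \<in> S\<close>] by (auto simp: cofinal_in_def otype_omega1_def)
    \<comment> \<open>There are points below \<alpha>, so closure under the constant function
      \<delta> is not vacuous.\<close>
    then have "\<delta> < \<alpha>"
      using \<alpha>(2) by (auto simp: closed_under_def)
    have repeat: "\<exists>y\<in>B \<alpha>. \<exists>y'\<in>B \<alpha>. y \<noteq> y' \<and> f y = u \<zeta> \<and> f y' = u \<zeta>" if "\<zeta> < omega1" for \<zeta>
    proof -
      obtain a a' where a: "a \<in> A \<alpha>" "a' \<in> A \<alpha>" "a \<noteq> a'" "c \<alpha> a = \<zeta>" "c \<alpha> a' = \<zeta>"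
        using twice[OF \<open>\<alpha> \<in> S\<close> \<open>\<zeta> < omega1\<close>] by blast
      have "f (F (p a \<zeta>)) = u \<zeta>" "f (F (p a' \<zeta>)) = u \<zeta>"
        using F[of "p a \<zeta>"] F[of "p a' \<zeta>"] by (auto simp: X_def \<rho>)
      moreover have "F (p a \<zeta>) \<in> B \<alpha>" "F (p a' \<zeta>) \<in> B \<alpha>"
        unfolding \<alpha>(3) A'_def using a(1,2) by (metis a(4) image_eqI, metis a(5) image_eqI)
      moreover have "F (p a \<zeta>) \<noteq> F (p a' \<zeta>)"
        using \<open>inj F\<close> a(3) p by (auto dest: injD)
      ultimately show ?thesis
        by blast
    qed
    obtain x where x: "x \<in> Q \<alpha>" "\<And>y. y \<in> Q \<alpha> \<Longrightarrow> f y = f x \<Longrightarrow> y = x"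
      using bspec[OF unique rangeI[of Q \<alpha>]] by auto
    \<comment> \<open>On block \<alpha>, beyond \<delta>, the colour is big and fixed by
      \<open>u\<close>; on the image it is a value of \<open>u\<close> by the choice of
      \<open>F\<close>. Either way \<open>repeat\<close> provides two points of this colour.\<close>
    have "\<exists>\<zeta><omega1. f x = u \<zeta>"
    proof (cases "x \<in> P \<alpha>")
      case True
      then show ?thesis
        using big_P \<open>\<delta> < \<alpha>\<close> f_less by (intro exI[of _ "f x"]) (auto simp: u_def)
    next
      case False
      then obtain a where "a \<in> A \<alpha>" "x = F (p a (c \<alpha> a))"
        using x(1) \<alpha> by (auto simp: Q_def A'_def)
      then show ?thesis
        using F[of "p a (c \<alpha> a)"] c[OF \<open>\<alpha> \<in> S\<close>] by (auto simp: X_def \<rho>)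
    qed
    then obtain y y' where "y \<in> B \<alpha>" "y' \<in> B \<alpha>" "y \<noteq> y'" "f y = f x" "f y' = f x"
      using repeat by metis
    then show False
      using x(2) \<alpha>(1) by (metis Q_def UnI2)
  qed
  ultimately show ?thesis
    by blast
qed

end

text \<open>The suprema are expressed by bounds: \<lambda> colours suffice for every system, while
  each \<open>r\<close> below \<lambda> is defeated by some system. Having no injection into
  \<open>omega1\<close> encodes \<kappa> \<ge> omega_2, and defeating omega_1 colours gives the
  lower bound in (2).\<close>

theorem theorem9p1:
  fixes S :: "'a::wellorder set"
  assumes "is_regular_type TYPE('a)"
    and "above_continuum TYPE('a)"
    and "stationary S"
    and "S \<subseteq> {\<alpha>. cf_omega1 \<alpha>}"
    and "bigstar S"
    and "diamond S"
  shows "((\<exists>S'\<subseteq>S. \<exists>B. clubsuit_seq S' B \<and> almost_disjoint_seq S' B) \<and>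
          (\<forall>\<A>::'b set set. omega_system \<A> (UNIV::'a set) {..<(omega1::'a)} \<longrightarrow>
              colorable_by \<A> (UNIV::'a set) \<and> cf_colorable_by \<A> (UNIV::'a set)) \<and>
          (\<forall>r::'a. \<exists>\<A>::'a set set. omega_system \<A> (UNIV::'a set) {..<(omega1::'a)} \<and>
              \<not> colorable_by \<A> {..<r}) \<and>
          (\<forall>r::'a. \<exists>\<A>::'a set set. omega_system \<A> (UNIV::'a set) {..<(omega1::'a)} \<and>
              \<not> cf_colorable_by \<A> {..<r})) \<and>
         (\<forall>k::'a. is_cardinal_ord k \<and> \<not> (\<exists>f. inj_on f {..<k} \<and> f ` {..<k} \<subseteq> {..<(omega1::'a)}) \<longrightarrow>
            (\<exists>\<A>::'a set set. omega_system \<A> (UNIV::'a set) {..<k} \<and>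
               \<not> cf_colorable_by \<A> {..<(omega1::'a)}))"
proof -
  interpret regular_above_continuum "TYPE('a)"
    using assms(1,2) by unfold_locales
  have W: "infinite {..<omega1::'a}"
    using otype_omega1_lessThan_omega1 by (simp add: otype_omega1_def uncountable_infinite)
  obtain S' B where S': "S' \<subseteq> S" "clubsuit_seq S' B" "almost_disjoint_seq S' B"
    and B: "\<And>\<alpha>. \<alpha> \<in> S' \<Longrightarrow> B \<alpha> \<approx> {..<omega1::'a}"
    using almost_disjoint_clubsuit[OF assms(5,6)] by blast
  have sys: "omega_system (B ` S') (UNIV :: 'a set) {..<omega1::'a}"
    and not_col: "\<And>r::'a. \<not> colorable_by (B ` S') {..<r}"
    using clubsuit_system[OF S'(2,3) B W] by blast+
  have not_cf: "\<not> cf_colorable_by (B ` S') {..<r}" for r :: 'a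
    using cf_colorable_imp_colorable[OF sys W] not_col by blast
  have system: "\<exists>\<A>::'a set set. omega_system \<A> (UNIV::'a set) {..<k} \<and>
      \<not> cf_colorable_by \<A> {..<(omega1::'a)}"
    if k: "\<not> (\<exists>f. inj_on f {..<k} \<and> f ` {..<k} \<subseteq> {..<(omega1::'a)})" for k :: 'a
  proof (rule not_cf_colorable_system[OF assms(5,6)])
    \<comment> \<open>Comparability of cardinals turns the missing injection into an embedding of
      \<open>omega1\<close>.\<close>
    show le: "{..<omega1::'a} \<lesssim> {..<k}"
      using k lepoll_total unfolding lepoll_def by blast
    show "infinite {..<k}"
      using le W finite_lepoll_infinite lepoll_antisym eqpoll_finite_iff by blast
  qed
  show ?thesis
  proof (intro conjI allI impI)
    show "\<exists>S'\<subseteq>S. \<exists>B. clubsuit_seq S' B \<and> almost_disjoint_seq S' B"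
      using S' by blast
    show "\<exists>\<A>::'a set set. omega_system \<A> (UNIV::'a set) {..<(omega1::'a)} \<and>
        \<not> colorable_by \<A> {..<r}" for r :: 'a
      by (intro exI conjI) (rule sys, rule not_col)
    show "\<exists>\<A>::'a set set. omega_system \<A> (UNIV::'a set) {..<(omega1::'a)} \<and>
        \<not> cf_colorable_by \<A> {..<r}" for r :: 'a
      by (intro exI conjI) (rule sys, rule not_cf)
  next
    fix \<A> :: "'b set set"
    assume "omega_system \<A> (UNIV :: 'a set) {..<omega1::'a}"
    then show "colorable_by \<A> (UNIV :: 'a set)" "cf_colorable_by \<A> (UNIV :: 'a set)"
      using omega1_system_colorable by auto
  next
    fix k :: 'a
    assume "is_cardinal_ord k \<and>
      \<not> (\<exists>f. inj_on f {..<k} \<and> f ` {..<k} \<subseteq> {..<(omega1::'a)})"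
    then show "\<exists>\<A>::'a set set. omega_system \<A> (UNIV::'a set) {..<k} \<and>
        \<not> cf_colorable_by \<A> {..<(omega1::'a)}"
      by (intro system) (rule conjunct2)
  qed
qed

end
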